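(* Let the relative rotation $R_s^\top R_t$ be known for some $s,t\in[0,T]$. (1) If $R_s\boldsymbol e^3\neq\pm R_t\boldsymbol e^3$, then the relative translation $R_s^\top R_t\boldsymbol d_t-\boldsymbol d_s$ is uniquely determined from the scaled measurements $\mu_s$ and $\mu_t$ by the equations $$e^{i\langle R_t\boldsymbol d_t-R_s\boldsymbol d_s,\boldsymbol\sigma_{s,t}(\beta)\rangle}=\frac{\mu_s(\boldsymbol\gamma_{s,t}(\beta))}{\mu_t(\boldsymbol\gamma_{t,s}(-\beta))}\quad\text{for all }\beta\in J_{s,t}\text{ with }\mu_s(\boldsymbol\gamma_{s,t}(\beta))\neq0$$ and $$e^{i\langle R_t\boldsymbol d_t-R_s\boldsymbol d_s,\boldsymbol\sigma^*_{s,t}(\beta)\rangle}=\frac{\mu_s(\boldsymbol\gamma^*_{s,t}(\beta))}{\overline{\mu_t(\boldsymbol\gamma^*_{t,s}(\beta))}}\quad\text{for all }\beta\in J^*_{s,t}\text{ with }\mu_s(\boldsymbol\gamma^*_{s,t}(\beta))\neq0.$$ (2) If $R_s\boldsymbol e^3=\pm R_t\boldsymbol e^3$, then the relative translation $R_s^\top R_t\boldsymbol d_t-\boldsymbol d_s$ is uniquely determined from the scaled measurements $\mu_s$ and $\mu_t$ by the following equation: in the case $R_s\boldsymbol e^3=R_t\boldsymbol e^3$, where $R_s^\top R_t=Q^{(3)}(\alpha)$ for some $\alpha\in\mathbb{R}/(2\pi\mathbb{Z})$, by $$e^{i\langle R_t\boldsymbol d_t-R_s\boldsymbol d_s,R_s\boldsymbol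 h(\boldsymbol k)\rangle}=\frac{\mu_s(\boldsymbol k)}{\mu_t(\mathrm{Q}(-\alpha)\boldsymbol k)}\quad\text{for all }\boldsymbol k\in\mathcal{B}^2_{k_0}\text{ with }\mu_s(\boldsymbol k)\neq0;$$ in the case $R_s\boldsymbol e^3=-R_t\boldsymbol e^3$, where $R_s^\top R_t=Q^{(2)}(\pi)Q^{(3)}(\alpha)$ for some $\alpha\in\mathbb{R}/(2\pi\mathbb{Z})$, by $$e^{i\langle R_t\boldsymbol d_t-R_s\boldsymbol d_s,R_s\boldsymbol h(\boldsymbol k)\rangle}=\frac{\mu_s(\boldsymbol k)}{\overline{\mu_t(\mathrm{Q}(-\alpha)\mathrm{S}\boldsymbol k)}}\quad\text{for all }\boldsymbol k\in\mathcal{B}^2_{k_0}\text{ with }\mu_s(\boldsymbol k)\neq0.$$ Here "uniquely determined by the equations" means that $\boldsymbol x=R_s^\top R_t\boldsymbol d_t-\boldsymbol d_s$ is the only vector $\boldsymbol x\in\mathbb{R}^3$ for which the equations hold with $R_t\boldsymbol d_t-R_s\boldsymbol d_s$ replaced by $R_s\boldsymbol x$.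
   Context: Fix $k_0>0$, $T>0$. $f\colon\mathbb{R}^3\to[0,\infty)$ (the scattering potential) is a piecewise continuous function with support in an open ball around $\boldsymbol 0$; $\mathcal{F}[f](\boldsymbol y)=(2\pi)^{-3/2}\int_{\mathbb{R}^3}f(\boldsymbol x)\,e^{-i\langle\boldsymbol x,\boldsymbol y\rangle}\,d\boldsymbol x$. For each $t\in[0,T]$ let $R_t\in\mathrm{SO}(3)$ and $\boldsymbol d_t\in\mathbb{R}^3$, with $R_0=I$, $\boldsymbol d_0=\boldsymbol 0$. $\boldsymbol e^3=(0,0,1)^\top$. For $\boldsymbol k\in\mathcal{B}^2_{k_0}=\{\boldsymbol k\in\mathbb{R}^2:\|\boldsymbol k\|<k_0\}$ let $\boldsymbol h(\boldsymbol k)=(k_1,k_2,\sqrt{k_0^2-\|\boldsymbol k\|^2}-k_0)^\top$, and let the scaled measurement data be $$\mu_t(\boldsymbol k)=\mathcal{F}[f](R_t\boldsymbol h(\boldsymbol k))\,e^{-i\langle\boldsymbol d_t,\boldsymbol h(\boldsymbol k)\rangle}.$$ Matrices: $\mathrm{S}=\begin{pmatrix}1&0\\0&-1\end{pmatrix}$, $\mathrm{Q}(\alpha)=\begin{pmatrix}\cos\alpha&-\sin\alpha\\\sin\alpha&\cos\alpha\end{pmatrix}$, $Q^{(2)}(\alpha)=\begin{pmatrix}\cos\alpha&0&\sin\alpha\\0&1&0\\-\sin\alpha&0&\cos\alpha\end{pmatrix}$, $Q^{(3)}(\alpha)=\begin{pmatrix}\cos\alpha&-\sin\alpha&0\\\sin\alpha&\cos\alpha&0\\0&0&1\end{pmatrix}$.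 For $R_s\boldsymbol e^3\neq\pm R_t\boldsymbol e^3$ put $c=\langle R_s\boldsymbol e^3,R_t\boldsymbol e^3\rangle$, $P(x_1,x_2,x_3)^\top=(x_1,x_2)^\top$, $$\boldsymbol v^1_{s,t}=\tfrac{R_s\boldsymbol e^3+R_t\boldsymbol e^3}{\|R_s\boldsymbol e^3+R_t\boldsymbol e^3\|},\quad \boldsymbol v^2_{s,t}=\tfrac{R_s\boldsymbol e^3\times R_t\boldsymbol e^3}{\|R_s\boldsymbol e^3\times R_t\boldsymbol e^3\|},\quad \boldsymbol v^3_{s,t}=\tfrac{R_s\boldsymbol e^3-R_t\boldsymbol e^3}{\|R_s\boldsymbol e^3-R_t\boldsymbol e^3\|},$$ $$\boldsymbol w^1_{s,t}=\tfrac{P(R_s^\top R_t\boldsymbol e^3)}{\|P(R_s^\top R_t\boldsymbol e^3)\|},\quad\boldsymbol w^2_{s,t}=\tfrac{P(\boldsymbol e^3\times R_s^\top R_t\boldsymbol e^3)}{\|P(\boldsymbol e^3\times R_s^\top R_t\boldsymbol e^3)\|},$$ $a_{s,t}=\frac{k_0}2\|R_s\boldsymbol e^3+R_t\boldsymbol e^3\|$, $a^*_{s,t}=\frac{k_0}2\|R_s\boldsymbol e^3-R_t\boldsymbol e^3\|$, $\tilde a_{s,t}=\frac{k_0}2\|P(R_s^\top R_t\boldsymbol e^3)\|$, and $$\boldsymbol\sigma_{s,t}(\beta)=a_{s,t}(\cos\beta-1)\boldsymbol v^1_{s,t}+a_{s,t}\sin\beta\,\boldsymbol v^2_{s,t},\qquad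 \boldsymbol\sigma^*_{s,t}(\beta)=a^*_{s,t}(\cos\beta-1)\boldsymbol v^3_{s,t}-a^*_{s,t}\sin\beta\,\boldsymbol v^2_{s,t},$$ $$\boldsymbol\gamma_{s,t}(\beta)=\tilde a_{s,t}(\cos\beta-1)\boldsymbol w^1_{s,t}+a_{s,t}\sin\beta\,\boldsymbol w^2_{s,t},\qquad \boldsymbol\gamma^*_{s,t}(\beta)=-\tilde a_{s,t}(\cos\beta-1)\boldsymbol w^1_{s,t}-a^*_{s,t}\sin\beta\,\boldsymbol w^2_{s,t};$$ $\boldsymbol\gamma_{t,s}$, $\boldsymbol\gamma^*_{t,s}$ are defined by the same formulas with $s$ and $t$ exchanged. $J_{s,t}=(-\pi,\pi]$ if $c\le0$ and $J_{s,t}=(-\beta_{s,t},\beta_{s,t})$ with $\beta_{s,t}=\arccos\frac{c-1}{c+1}$ if $c>0$; $J^*_{s,t}=(-\pi,\pi]$ if $c\ge0$ and $J^*_{s,t}=(-\beta^*_{s,t},\beta^*_{s,t})$ with $\beta^*_{s,t}=\arccos\frac{c+1}{c-1}$ if $c<0$.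
   Formalization: The formal theorem additionally assumes that the scattering potential f is not zero almost everywhere; for f = 0 a.e. all measurements vanish, no equations remain, and uniqueness fails. *)

theory Defs
  imports "HOL-Analysis.Analysis"
begin

unbundle cross3_syntax

text \<open>Piecewise continuity: finitely many open pieces cover space up to a null set, and on each
  piece the function has a continuous (real-valued) extension to the closure of the piece, i.e.
  finite one-sided limits at the interfaces.  Values on the interfaces are arbitrary.\<close>

definition piecewise_continuous :: "(real^3 \<Rightarrow> real) \<Rightarrow> bool" where
  "piecewise_continuous f \<longleftrightarrow>
     (\<exists>\<U>. finite \<U> \<and> disjoint \<U> \<and> (\<Union>U\<in>\<U>. closure U) = UNIV \<and>
        (\<forall>U\<in>\<U>. open U \<and> negligible (frontier U) \<and>
           (\<exists>g. continuous_on (closure U) g \<and> (\<forall>x\<in>U. f x = g x))))"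

text \<open>The integral is taken with respect to \<open>lebesgue\<close> rather than \<open>lborel\<close>: with arbitrary values
  on the interfaces, a piecewise continuous function need not be Borel measurable.\<close>

definition fourier :: "(real^3 \<Rightarrow> real) \<Rightarrow> real^3 \<Rightarrow> complex" where
  "fourier f y = complex_of_real ((2 * pi) powr (-3/2)) *
     (LINT x|lebesgue. complex_of_real (f x) * exp (- \<i> * complex_of_real (x \<bullet> y)))"

definition e3 :: "real^3" where
  "e3 = vector [0, 0, 1]"

definition P :: "real^3 \<Rightarrow> real^2" where
  "P x = vector [x$1, x$2]"

definition h :: "real \<Rightarrow> real^2 \<Rightarrow> real^3" where
  "h k\<^sub>0 k = vector [k$1, k$2, sqrt (k\<^sub>0\<^sup>2 - (norm k)\<^sup>2) - k\<^sub>0]"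

text \<open>The data are given for \<open>norm k < k\<^sub>0\<close>.  On the circle \<open>norm k = k\<^sub>0\<close>, reached below
  only if \<open>c = 0\<close> and \<open>\<beta> = pi\<close>, the same formula gives the continuous extension.\<close>

definition \<mu> :: "(real^3 \<Rightarrow> real) \<Rightarrow> real \<Rightarrow> (real \<Rightarrow> real^3^3) \<Rightarrow> (real \<Rightarrow> real^3)
    \<Rightarrow> real \<Rightarrow> real^2 \<Rightarrow> complex" where
  "\<mu> f k\<^sub>0 R d t k =
     fourier f (R t *v h k\<^sub>0 k) * exp (- \<i> * complex_of_real (d t \<bullet> h k\<^sub>0 k))"

definition S :: "real^2^2" where
  "S = vector [vector [1, 0], vector [0, -1]]"

definition Q :: "real \<Rightarrow> real^2^2" where
  "Q \<alpha> = vector [vector [cos \<alpha>, - sin \<alpha>], vector [sin \<alpha>, cos \<alpha>]]"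

definition Q2 :: "real \<Rightarrow> real^3^3" where
  "Q2 \<alpha> = vector [vector [cos \<alpha>, 0, sin \<alpha>],
                  vector [0, 1, 0],
                  vector [- sin \<alpha>, 0, cos \<alpha>]]"

definition Q3 :: "real \<Rightarrow> real^3^3" where
  "Q3 \<alpha> = vector [vector [cos \<alpha>, - sin \<alpha>, 0],
                  vector [sin \<alpha>, cos \<alpha>, 0],
                  vector [0, 0, 1]]"

text \<open>Below, the arguments \<open>A\<close>, \<open>B\<close> stand for \<open>R s\<close>, \<open>R t\<close>; exchanging them exchanges
  \<open>s\<close> and \<open>t\<close>.\<close>

definition c :: "real^3^3 \<Rightarrow> real^3^3 \<Rightarrow> real" where
  "c A B = (A *v e3) \<bullet> (B *v e3)"

definition v1 :: "real^3^3 \<Rightarrow> real^3^3 \<Rightarrow> real^3" where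
  "v1 A B = (A *v e3 + B *v e3) /\<^sub>R norm (A *v e3 + B *v e3)"

definition v2 :: "real^3^3 \<Rightarrow> real^3^3 \<Rightarrow> real^3" where
  "v2 A B = ((A *v e3) \<times> (B *v e3)) /\<^sub>R norm ((A *v e3) \<times> (B *v e3))"

definition v3 :: "real^3^3 \<Rightarrow> real^3^3 \<Rightarrow> real^3" where
  "v3 A B = (A *v e3 - B *v e3) /\<^sub>R norm (A *v e3 - B *v e3)"

definition w1 :: "real^3^3 \<Rightarrow> real^3^3 \<Rightarrow> real^2" where
  "w1 A B = P ((transpose A ** B) *v e3) /\<^sub>R norm (P ((transpose A ** B) *v e3))"

definition w2 :: "real^3^3 \<Rightarrow> real^3^3 \<Rightarrow> real^2" where
  "w2 A B = P (e3 \<times> ((transpose A ** B) *v e3)) /\<^sub>R norm (P (e3 \<times> ((transpose A ** B) *v e3)))"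

definition a :: "real \<Rightarrow> real^3^3 \<Rightarrow> real^3^3 \<Rightarrow> real" where
  "a k\<^sub>0 A B = k\<^sub>0 / 2 * norm (A *v e3 + B *v e3)"

definition a_star :: "real \<Rightarrow> real^3^3 \<Rightarrow> real^3^3 \<Rightarrow> real" where
  "a_star k\<^sub>0 A B = k\<^sub>0 / 2 * norm (A *v e3 - B *v e3)"

definition a_tilde :: "real \<Rightarrow> real^3^3 \<Rightarrow> real^3^3 \<Rightarrow> real" where
  "a_tilde k\<^sub>0 A B = k\<^sub>0 / 2 * norm (P ((transpose A ** B) *v e3))"

definition \<sigma> :: "real \<Rightarrow> real^3^3 \<Rightarrow> real^3^3 \<Rightarrow> real \<Rightarrow> real^3" where
  "\<sigma> k\<^sub>0 A B \<beta> =
     (a k\<^sub>0 A B * (cos \<beta> - 1)) *\<^sub>R v1 A B + (a k\<^sub>0 A B * sin \<beta>) *\<^sub>R v2 A B"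

definition \<sigma>_star :: "real \<Rightarrow> real^3^3 \<Rightarrow> real^3^3 \<Rightarrow> real \<Rightarrow> real^3" where
  "\<sigma>_star k\<^sub>0 A B \<beta> =
     (a_star k\<^sub>0 A B * (cos \<beta> - 1)) *\<^sub>R v3 A B - (a_star k\<^sub>0 A B * sin \<beta>) *\<^sub>R v2 A B"

definition \<gamma> :: "real \<Rightarrow> real^3^3 \<Rightarrow> real^3^3 \<Rightarrow> real \<Rightarrow> real^2" where
  "\<gamma> k\<^sub>0 A B \<beta> =
     (a_tilde k\<^sub>0 A B * (cos \<beta> - 1)) *\<^sub>R w1 A B + (a k\<^sub>0 A B * sin \<beta>) *\<^sub>R w2 A B"

definition \<gamma>_star :: "real \<Rightarrow> real^3^3 \<Rightarrow> real^3^3 \<Rightarrow> real \<Rightarrow> real^2" where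
  "\<gamma>_star k\<^sub>0 A B \<beta> =
     - ((a_tilde k\<^sub>0 A B * (cos \<beta> - 1)) *\<^sub>R w1 A B) - (a_star k\<^sub>0 A B * sin \<beta>) *\<^sub>R w2 A B"

definition J :: "real^3^3 \<Rightarrow> real^3^3 \<Rightarrow> real set" where
  "J A B = (if c A B \<le> 0 then {-pi<..pi}
            else {- arccos ((c A B - 1) / (c A B + 1)) <..< arccos ((c A B - 1) / (c A B + 1))})"

definition J_star :: "real^3^3 \<Rightarrow> real^3^3 \<Rightarrow> real set" where
  "J_star A B = (if c A B \<ge> 0 then {-pi<..pi}
            else {- arccos ((c A B + 1) / (c A B - 1)) <..< arccos ((c A B + 1) / (c A B - 1))})"

end

theory Submission
  imports Defs
begin

text \<open>
  Fix two times with rotations \<open>A\<close>, \<open>B\<close> and put \<open>w = B d\<^sub>t - A d\<^sub>s\<close>; since \<open>A\<close> is invertible,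
  finding the relative translation is the same as finding \<open>w\<close>. The datum at \<open>k\<close> for time \<open>s\<close> is the
  Fourier transform of \<open>f\<close> at the frequency \<open>A h(k)\<close>, multiplied by a phase that depends linearly
  on \<open>d\<^sub>s\<close>. Whenever the two times see the same frequency \<open>p = A h(k) = B h(l)\<close>, the Fourier factors
  cancel in the quotient and the phase \<open>exp (i \<langle>w, p\<rangle>)\<close> is left. As \<open>f\<close> is real, its Fourier
  transform takes conjugate values at \<open>p\<close> and \<open>-p\<close>, so antipodal frequencies
  \<open>B h(l) = - A h(k)\<close> serve equally well after a conjugation (\<open>data_ratio\<close>,
  \<open>data_ratio_antipodal\<close>).

  The frequencies seen at time \<open>s\<close> form an open hemisphere through the origin of the sphere of radius
  \<open>k\<^sub>0\<close> around \<open>- k\<^sub>0 A e\<^sub>3\<close>. For independent axes, two such spheres meet in a circle, which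
  \<open>\<sigma>\<close> parametrises; that the formula for \<open>\<gamma>\<close> recovers the parameter \<open>k\<close> is
  \<open>rotation_h_\<gamma>\<close>, where the range \<open>J\<close> is what keeps \<open>\<sigma>\<close> on the closed hemisphere. The starred
  objects arise by intersecting with the reflected sphere, that is, by replacing \<open>B\<close> with \<open>-B\<close>
  (\<open>star_eq_minus\<close>), so nothing has to be shown twice. For parallel or antiparallel axes the whole
  hemispheres coincide up to a sign.

  This makes \<open>w\<close> a solution. For uniqueness, only frequencies near the origin matter: there the
  Fourier transform does not vanish, because \<open>\<integral> f > 0\<close> and because it is continuous. If \<open>z\<close> is
  another solution, \<open>\<langle>z - w, p\<rangle>\<close> is an integer multiple of \<open>2\<pi>\<close> that tends to \<open>0\<close> with \<open>p\<close>, hence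
  it vanishes for all observed \<open>p\<close> near the origin
  (\<open>phase_eq_imp_eventually_orthogonal\<close>). These \<open>p\<close> span \<open>\<real>\<^sup>3\<close>: one arc spans the plane of
  \<open>A e\<^sub>3 + B e\<^sub>3\<close> and \<open>A e\<^sub>3 \<times> B e\<^sub>3\<close>, the starred arc adds \<open>A e\<^sub>3 - B e\<^sub>3\<close>
  (\<open>phases_on_arc_determine\<close>), and a curved cap of a hemisphere lies in no plane
  (\<open>phases_on_hemisphere_determine\<close>).
\<close>

text \<open>The default rewriting of \<open>transpose A *v x\<close> to \<open>x v* A\<close> would hide that the transpose is the
  inverse rotation.\<close>

declare transpose_matrix_vector [simp del]

section \<open>The Fourier transform of the potential\<close>

text \<open>On each piece the continuous extension is bounded on the compact part inside the support ball. The
  interfaces, on which \<open>f\<close> is arbitrary and possibly unbounded, are negligible.\<close>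

lemma integrable_piecewise_continuous:
  assumes pc: "piecewise_continuous f"
    and supp: "closure {x. f x \<noteq> 0} \<subseteq> ball 0 r"
  shows "integrable lebesgue f"
proof -
  obtain \<U> where fin: "finite \<U>" and cov: "(\<Union>U\<in>\<U>. closure U) = UNIV"
    and \<U>: "\<And>U. U \<in> \<U> \<Longrightarrow> open U \<and> negligible (frontier U) \<and>
           (\<exists>g. continuous_on (closure U) g \<and> (\<forall>x\<in>U. f x = g x))"
    using pc unfolding piecewise_continuous_def by auto
  have zero: "f x = 0" if "x \<notin> cball 0 r" for x
    using that supp closure_subset[of "{x. f x \<noteq> 0}"] by (force simp: subset_iff)
  have piece: "f absolutely_integrable_on U" if U: "U \<in> \<U>" for U
  proof -
    obtain g where g: "continuous_on (closure U) g" "\<forall>x\<in>U. f x = g x" and "open U"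
      using \<U>[OF U] by auto
    let ?K = "closure U \<inter> cball 0 r"
    have "integrable lborel (\<lambda>x. indicator ?K x *\<^sub>R g x)"
      by (rule borel_integrable_compact) (auto intro: continuous_on_subset[OF g(1)] closed_Int_compact)
    then have "g absolutely_integrable_on ?K"
      unfolding set_integrable_def using integrable_completion borel_measurable_integrable by blast
    then have "g absolutely_integrable_on (U \<inter> cball 0 r)"
      by (rule set_integrable_subset) (use \<open>open U\<close> closure_subset in auto)
    moreover have "(\<lambda>x. indicator (U \<inter> cball 0 r) x *\<^sub>R g x) = (\<lambda>x. indicator U x *\<^sub>R f x)"
      using g(2) zero by (auto simp: indicator_def fun_eq_iff)
    ultimately show ?thesis
      unfolding set_integrable_def by simp
  qed
  have *: "f absolutely_integrable_on (\<Union>U\<in>\<U>. U)"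
    by (rule set_integrable_UN) (use fin piece \<U> in auto)
  have "f absolutely_integrable_on UNIV"
  proof (rule absolutely_integrable_spike_set[OF *])
    have "UNIV - (\<Union>U\<in>\<U>. U) \<subseteq> (\<Union>U\<in>\<U>. frontier U)"
      using cov \<U> by (fastforce simp: frontier_def interior_open)
    moreover have "negligible (\<Union>U\<in>\<U>. frontier U)"
      using fin \<U> by (auto intro!: negligible_Union)
    ultimately have "negligible (UNIV - (\<Union>U\<in>\<U>. U))"
      using negligible_subset by blast
    then show "negligible {x \<in> UNIV - (\<Union>U\<in>\<U>. U). f x \<noteq> 0}"
      by (rule negligible_subset) auto
    show "negligible {x \<in> (\<Union>U\<in>\<U>. U) - UNIV. f x \<noteq> 0}" by simp
  qed
  then show ?thesis by (simp add: set_integrable_def)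
qed

lemma isCont_fourier:
  assumes f: "integrable lebesgue f"
  shows "isCont (fourier f) y"
  unfolding continuous_at_sequentially o_def
proof (intro allI impI)
  fix u :: "nat \<Rightarrow> real^3" assume u: "u \<longlonglongrightarrow> y"
  have meas: "(\<lambda>x. complex_of_real (f x) * exp (- \<i> * complex_of_real (x \<bullet> v)))
      \<in> borel_measurable lebesgue" for v
  proof (rule borel_measurable_times)
    show "(\<lambda>x. complex_of_real (f x)) \<in> borel_measurable lebesgue"
      using borel_measurable_integrable[OF f] by measurable
    have "(\<lambda>x::real^3. exp (- \<i> * complex_of_real (x \<bullet> v))) \<in> borel_measurable borel"
      by (intro borel_measurable_continuous_onI continuous_intros)
    then show "(\<lambda>x::real^3. exp (- \<i> * complex_of_real (x \<bullet> v))) \<in> borel_measurable lebesgue"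
      by (intro measurable_completion) simp
  qed
  have "(\<lambda>n. LINT x|lebesgue. complex_of_real (f x) * exp (- \<i> * complex_of_real (x \<bullet> u n)))
      \<longlonglongrightarrow> (LINT x|lebesgue. complex_of_real (f x) * exp (- \<i> * complex_of_real (x \<bullet> y)))"
  proof (rule integral_dominated_convergence[where w = "\<lambda>x. norm (f x)"])
    show "integrable lebesgue (\<lambda>x. norm (f x))" using f by (rule integrable_norm)
    show "AE x in lebesgue. (\<lambda>n. complex_of_real (f x) * exp (- \<i> * complex_of_real (x \<bullet> u n)))
        \<longlonglongrightarrow> complex_of_real (f x) * exp (- \<i> * complex_of_real (x \<bullet> y))"
      by (intro AE_I2 tendsto_intros u)
  qed (use meas in \<open>auto simp: norm_mult\<close>)
  then show "(\<lambda>n. fourier f (u n)) \<longlonglongrightarrow> fourier f y"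
    unfolding fourier_def by (intro tendsto_intros)
qed

text \<open>Conjugation only reverses the sign of the frequency, because \<open>f\<close> is real-valued.\<close>

lemma fourier_minus: "fourier f (- y) = cnj (fourier f y)"
  unfolding fourier_def complex_cnj_mult complex_cnj_complex_of_real
    Bochner_Integration.integral_cnj[symmetric]
  by (simp add: exp_cnj)

lemma fourier_0_nonzero:
  assumes f: "integrable lebesgue f" and nn: "\<And>x. f x \<ge> 0"
    and nz: "\<not> (AE x in lebesgue. f x = 0)"
  shows "fourier f 0 \<noteq> 0"
proof -
  have "(LINT x|lebesgue. f x) \<noteq> 0"
    using integral_nonneg_eq_0_iff_AE[OF f] nn nz by auto
  then show ?thesis by (simp add: fourier_def)
qed

section \<open>Recovering inner products from phases\<close>

lemma isCont_tendsto_nhds: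
  fixes g :: "'b::t2_space \<Rightarrow> 'c::t2_space"
  shows "isCont g p \<Longrightarrow> (g \<longlongrightarrow> g p) (nhds p)"
  by (simp only: isCont_def tendsto_at_iff_tendsto_nhds)

text \<open>Equal exponentials only say that the phases differ by a multiple of \<open>2\<pi>\<close>; continuity at a point
  where both phases vanish forces that multiple to be \<open>0\<close> nearby.\<close>

lemma phase_eq_imp_eventually_orthogonal:
  fixes \<phi> :: "'b::t2_space \<Rightarrow> real^3"
  assumes cont: "isCont \<phi> p" and p: "\<phi> p = 0"
    and ev: "eventually (\<lambda>q. exp (\<i> * complex_of_real (z \<bullet> \<phi> q)) =
      exp (\<i> * complex_of_real (w \<bullet> \<phi> q))) (nhds p)"
  shows "eventually (\<lambda>q. (z - w) \<bullet> \<phi> q = 0) (nhds p)"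
proof -
  have lim: "((\<lambda>q. (z - w) \<bullet> \<phi> q) \<longlongrightarrow> 0) (nhds p)"
    using tendsto_inner[OF tendsto_const isCont_tendsto_nhds[OF cont], of "z - w"] p by simp
  have small: "eventually (\<lambda>q. \<bar>(z - w) \<bullet> \<phi> q\<bar> < 2 * pi) (nhds p)"
    using tendstoD[OF lim, of "2 * pi"] by (simp add: dist_real_def)
  show ?thesis
    using small ev
  proof eventually_elim
    case (elim q)
    from elim(2) obtain n :: int where
      n: "z \<bullet> \<phi> q = w \<bullet> \<phi> q + 2 * of_int n * pi"
      unfolding exp_eq by (auto simp: complex_eq_iff)
    then have "\<bar>of_int n :: real\<bar> < 1"
      using elim(1) by (simp add: inner_diff_left abs_mult)
    then have "n = 0" by linarith
    with n show ?case by (simp add: inner_diff_left)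
  qed
qed

section \<open>Rotations and cross products\<close>

lemma rotation_transpose_cancel:
  fixes A :: "real^3^3"
  assumes "rotation_matrix A"
  shows "transpose A *v (A *v x) = x" "A *v (transpose A *v x) = x"
  using assms by (simp_all add: rotation_matrix_def orthogonal_matrix_def matrix_vector_mul_assoc)

lemma rotation_inner:
  fixes A :: "real^3^3"
  assumes "rotation_matrix A"
  shows "(A *v x) \<bullet> (A *v y) = x \<bullet> y"
  by (metis assms dot_lmul_matrix rotation_transpose_cancel(1) transpose_matrix_vector inner_commute)

lemma rotation_norm:
  fixes A :: "real^3^3"
  assumes "rotation_matrix A"
  shows "norm (A *v x) = norm x"
  by (simp add: norm_eq_sqrt_inner rotation_inner[OF assms])

lemma rotation_matrix_transpose:
  fixes A :: "real^3^3"
  shows "rotation_matrix A \<Longrightarrow> rotation_matrix (transpose A)"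
  by (simp add: rotation_matrix_def)

lemma matrix_vector_minus: "A *v (- x) = - (A *v (x::real^'n))"
  by (rule linear_neg) simp

lemma minus_matrix_vector: "(- B) *v x = - (B *v (x::real^'n))"
  using matrix_vector_mult_diff_rdistrib[of 0 B x] by simp

lemma rotation_matrix_mult:
  fixes A B :: "real^'n^'n"
  shows "rotation_matrix A \<Longrightarrow> rotation_matrix B \<Longrightarrow> rotation_matrix (A ** B)"
  by (simp add: rotation_matrix_def orthogonal_matrix_mul det_mul)

lemma cross_nonzero_of_unit:
  fixes u v :: "real^3"
  assumes "norm u = 1" "norm v = 1" "u \<noteq> v" "u \<noteq> - v"
  shows "u \<times> v \<noteq> 0"
proof
  assume "u \<times> v = 0"
  then have "(u \<bullet> v)\<^sup>2 = 1" using norm_cross[of u v] assms(1,2) by simp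
  moreover have "(norm (u - v))\<^sup>2 = 2 - 2 * (u \<bullet> v)" "(norm (u + v))\<^sup>2 = 2 + 2 * (u \<bullet> v)"
    using assms(1,2)
    by (simp_all add: power2_norm_eq_inner norm_eq_1 inner_diff inner_add inner_commute)
  moreover have "u - v \<noteq> 0" "u + v \<noteq> 0"
    using assms(3,4) by (auto simp: eq_neg_iff_add_eq_0)
  ultimately have "u \<bullet> v \<noteq> 1" "u \<bullet> v \<noteq> -1" by auto
  with \<open>(u \<bullet> v)\<^sup>2 = 1\<close> show False by (simp add: power2_eq_1_iff)
qed

lemma eq_0_of_orthogonal_cross:
  fixes u v y :: "real^3"
  assumes "u \<times> v \<noteq> 0" "y \<bullet> u = 0" "y \<bullet> v = 0" "y \<bullet> (u \<times> v) = 0"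
  shows "y = 0"
proof -
  have "y \<times> (u \<times> v) = (y \<bullet> v) *\<^sub>R u - (y \<bullet> u) *\<^sub>R v"
    by (rule Lagrange)
  then have "y \<times> (u \<times> v) = 0" by (simp only: assms scaleR_zero_left diff_0_right)
  then show ?thesis using assms(1,4) norm_and_cross_eq_0 by blast
qed

section \<open>Ratios of data at equal and antipodal frequencies\<close>

lemma norm_e3 [simp]: "norm e3 = 1"
  by (simp add: norm_eq_sqrt_inner inner_vec_def sum_3 e3_def)

lemma inner_e3: "x \<bullet> e3 = x $ 3"
  by (simp add: inner_vec_def sum_3 e3_def)

lemma data_nonzero_iff:
  "\<mu> f k\<^sub>0 R d s k \<noteq> 0 \<longleftrightarrow> fourier f (R s *v h k\<^sub>0 k) \<noteq> 0"
  by (simp add: \<mu>_def)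

text \<open>The inner product \<open>d\<^sub>t \<bullet> h(l)\<close> equals \<open>B d\<^sub>t \<bullet> B h(l)\<close>, so a common frequency \<open>A h(k) = B h(l)\<close>
  lets both phases be read off at the same point.\<close>

lemma data_ratio:
  assumes "rotation_matrix (R s)" "rotation_matrix (R t)"
    and eq: "R t *v h k\<^sub>0 l = R s *v h k\<^sub>0 k" and nz: "\<mu> f k\<^sub>0 R d s k \<noteq> 0"
  shows "\<mu> f k\<^sub>0 R d s k / \<mu> f k\<^sub>0 R d t l =
    exp (\<i> * complex_of_real ((R t *v d t - R s *v d s) \<bullet> (R s *v h k\<^sub>0 k)))"
proof -
  have "(R t *v d t) \<bullet> (R s *v h k\<^sub>0 k) = d t \<bullet> h k\<^sub>0 l"
    by (simp add: rotation_inner assms(2) flip: eq)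
  moreover have "(R s *v d s) \<bullet> (R s *v h k\<^sub>0 k) = d s \<bullet> h k\<^sub>0 k"
    by (rule rotation_inner[OF assms(1)])
  ultimately have phase: "\<i> * complex_of_real ((R t *v d t - R s *v d s) \<bullet> (R s *v h k\<^sub>0 k)) =
      - \<i> * complex_of_real (d s \<bullet> h k\<^sub>0 k) - (- \<i> * complex_of_real (d t \<bullet> h k\<^sub>0 l))"
    by (simp add: inner_diff_left right_diff_distrib)
  show ?thesis
    using nz unfolding phase exp_diff by (simp add: \<mu>_def eq)
qed

lemma data_ratio_antipodal:
  assumes "rotation_matrix (R s)" "rotation_matrix (R t)"
    and eq: "R t *v h k\<^sub>0 l = - (R s *v h k\<^sub>0 k)" and nz: "\<mu> f k\<^sub>0 R d s k \<noteq> 0"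
  shows "\<mu> f k\<^sub>0 R d s k / cnj (\<mu> f k\<^sub>0 R d t l) =
    exp (\<i> * complex_of_real ((R t *v d t - R s *v d s) \<bullet> (R s *v h k\<^sub>0 k)))"
proof -
  have "(R t *v d t) \<bullet> (R s *v h k\<^sub>0 k) = - ((R t *v d t) \<bullet> (R t *v h k\<^sub>0 l))"
    by (simp add: eq)
  also have "\<dots> = - (d t \<bullet> h k\<^sub>0 l)"
    by (simp only: rotation_inner[OF assms(2)])
  finally have "(R t *v d t) \<bullet> (R s *v h k\<^sub>0 k) = - (d t \<bullet> h k\<^sub>0 l)" .
  moreover have "(R s *v d s) \<bullet> (R s *v h k\<^sub>0 k) = d s \<bullet> h k\<^sub>0 k"
    by (rule rotation_inner[OF assms(1)])
  ultimately have phase: "\<i> * complex_of_real ((R t *v d t - R s *v d s) \<bullet> (R s *v h k\<^sub>0 k)) =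
      - \<i> * complex_of_real (d s \<bullet> h k\<^sub>0 k) - \<i> * complex_of_real (d t \<bullet> h k\<^sub>0 l)"
    by (simp add: inner_diff_left right_diff_distrib)
  have "cnj (\<mu> f k\<^sub>0 R d t l) =
      fourier f (R s *v h k\<^sub>0 k) * exp (\<i> * complex_of_real (d t \<bullet> h k\<^sub>0 l))"
    by (simp add: \<mu>_def eq fourier_minus exp_cnj)
  then show ?thesis
    using nz unfolding phase exp_diff by (simp add: \<mu>_def)
qed

section \<open>The arcs where two hemispheres of frequencies meet\<close>

text \<open>The first condition places \<open>x\<close> on the sphere of radius \<open>k\<^sub>0\<close> around \<open>(0, 0, -k\<^sub>0)\<close>, and the second on
  its upper half, over which the first two coordinates determine the third.\<close>

lemma h_P_eqI:
  assumes "x \<bullet> x + 2 * k\<^sub>0 * x $ 3 = 0" and "x $ 3 + k\<^sub>0 \<ge> 0"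
  shows "h k\<^sub>0 (P x) = x"
proof -
  have "(norm (P x))\<^sup>2 = (x $ 1)\<^sup>2 + (x $ 2)\<^sup>2"
    unfolding power2_norm_eq_inner by (simp add: P_def inner_vec_def sum_2 power2_eq_square)
  then have "k\<^sub>0\<^sup>2 - (norm (P x))\<^sup>2 = (x $ 3 + k\<^sub>0)\<^sup>2"
    using assms(1) by (simp add: inner_vec_def sum_3 power2_eq_square algebra_simps)
  then show ?thesis
    using assms(2) by (simp add: h_def P_def vec_eq_iff forall_3)
qed

lemma linear_P: "linear P"
  by (rule linearI) (auto simp: P_def vec_eq_iff forall_2)

text \<open>For \<open>c > 0\<close> the endpoint of the interval is where equality holds; for \<open>c \<le> 0\<close> the bound holds for
  every \<open>\<beta>\<close>. With \<open>A\<close>, \<open>B\<close> rotations the bound says that \<open>\<sigma>\<close> stays on the upper half of the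
  sphere.\<close>

lemma cos_bound_on_J:
  assumes "\<beta> \<in> J A B" and "c A B \<ge> -1"
  shows "(1 + c A B) * (1 - cos \<beta>) \<le> 2"
proof (cases "c A B \<le> 0")
  case True
  then show ?thesis
    using assms mult_mono[of "1 + c A B" 1 "1 - cos \<beta>" 2] cos_ge_minus_one[of \<beta>] by simp
next
  case False
  then have pos: "c A B > 0" by simp
  let ?q = "(c A B - 1) / (c A B + 1)"
  have q: "-1 \<le> ?q" "?q \<le> 1" using pos by (auto simp: field_simps)
  have "\<bar>\<beta>\<bar> < arccos ?q" using assms(1) pos by (auto simp: J_def)
  then have "cos (arccos ?q) \<le> cos \<bar>\<beta>\<bar>"
    using arccos_bounded[OF q] by (subst cos_mono_le_eq) auto
  then have "?q \<le> cos \<beta>" using q by (simp add: cos_arccos)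
  then show ?thesis using pos by (simp add: field_simps)
qed

lemma eventually_in_J: "eventually (\<lambda>\<beta>. \<beta> \<in> J A B) (nhds 0)"
proof -
  obtain b where "b > 0" "{-b<..<b} \<subseteq> J A B"
  proof (cases "c A B \<le> 0")
    case True
    then show ?thesis by (intro that[of pi]) (auto simp: J_def)
  next
    case False
    then have "0 < arccos ((c A B - 1) / (c A B + 1))"
      by (intro conjunct1[OF arccos_lt_bounded]) (auto simp: field_simps)
    with False show ?thesis by (intro that) (auto simp: J_def)
  qed
  moreover have "eventually (\<lambda>\<beta>. \<beta> \<in> {-b<..<b}) (nhds 0)"
    using \<open>b > 0\<close> by (intro eventually_nhds_in_open) auto
  ultimately show ?thesis
    by (metis (no_types, lifting) eventually_mono subsetD)
qed

text \<open>Multiplying \<open>v1\<close> by \<open>a\<close> undoes the normalisation, so no division is left in this coordinate.\<close>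

lemma \<sigma>_eq:
  "\<sigma> k\<^sub>0 A B \<beta> = (k\<^sub>0 / 2 * (cos \<beta> - 1)) *\<^sub>R (A *v e3 + B *v e3) + (a k\<^sub>0 A B * sin \<beta>) *\<^sub>R v2 A B"
  by (cases "A *v e3 + B *v e3 = 0") (simp_all add: \<sigma>_def a_def v1_def)

lemma isCont_\<sigma>: "isCont (\<sigma> k\<^sub>0 A B) \<beta>"
  unfolding \<sigma>_def by (intro continuous_intros)

text \<open>The vectors \<open>w1\<close>, \<open>w2\<close> are the normalised projections of \<open>v1\<close>, \<open>v2\<close> in the frame of \<open>A\<close>. The
  vector \<open>v2\<close> is perpendicular to \<open>A e\<^sub>3\<close> and keeps its length, whereas \<open>v1\<close> is shortened; the radius
  \<open>a_tilde\<close> in place of \<open>a\<close> accounts for that.\<close>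

lemma P_\<sigma>:
  assumes A: "rotation_matrix A"
  shows "P (transpose A *v \<sigma> k\<^sub>0 A B \<beta>) = \<gamma> k\<^sub>0 A B \<beta>"
proof -
  interpret P: linear P by (rule linear_P)
  let ?n = "(transpose A ** B) *v e3"
  have sum: "P (transpose A *v (A *v e3 + B *v e3)) = P ?n"
  proof -
    have "transpose A *v (A *v e3 + B *v e3) = e3 + ?n"
      by (simp only: matrix_vector_right_distrib rotation_transpose_cancel(1)[OF A]
          flip: matrix_vector_mul_assoc)
    moreover have "P e3 = 0" by (simp add: P_def e3_def vec_eq_iff forall_2)
    ultimately show ?thesis by (simp add: P.add)
  qed
  have cross: "transpose A *v ((A *v e3) \<times> (B *v e3)) = e3 \<times> ?n"
    by (metis A cross_rotation_matrix matrix_vector_mul_assoc rotation_matrix_transpose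
        rotation_transpose_cancel(1))
  have "norm ((A *v e3) \<times> (B *v e3)) = norm (e3 \<times> ?n)"
    by (metis A cross rotation_matrix_transpose rotation_norm)
  also have "\<dots> = norm (P (e3 \<times> ?n))"
    by (simp add: norm_eq_sqrt_inner inner_vec_def sum_3 sum_2 P_def e3_def cross3_def)
  finally have w2: "P (transpose A *v v2 A B) = w2 A B"
    by (simp add: v2_def w2_def matrix_vector_mult_scaleR P.scale cross)
  have "a_tilde k\<^sub>0 A B *\<^sub>R w1 A B = (k\<^sub>0 / 2) *\<^sub>R P ?n"
    by (cases "P ?n = 0") (simp_all add: a_tilde_def w1_def)
  then have w1: "(a_tilde k\<^sub>0 A B * (cos \<beta> - 1)) *\<^sub>R w1 A B = (k\<^sub>0 / 2 * (cos \<beta> - 1)) *\<^sub>R P ?n"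
    by (simp only: mult.commute[of _ "cos \<beta> - 1"] flip: scaleR_scaleR)
  have "P (transpose A *v (r *\<^sub>R x + q *\<^sub>R y)) = r *\<^sub>R P (transpose A *v x) + q *\<^sub>R P (transpose A *v y)"
    for r q x y
    by (simp only: matrix_vector_right_distrib matrix_vector_mult_scaleR P.add P.scale)
  then show ?thesis by (simp only: \<sigma>_eq \<gamma>_def w1 w2 sum)
qed

text \<open>As \<open>v1\<close> and \<open>v2\<close> are orthonormal, a direct computation puts \<open>\<sigma>\<close>, seen in the frame of \<open>A\<close>, on the
  sphere of \<open>h_P_eqI\<close>. The second direction is only required to be a unit vector, because the lemma
  is also applied to the reflected matrix \<open>-B\<close>, which is no rotation.\<close>

lemma rotation_h_\<gamma>:
  assumes A: "rotation_matrix A" and B: "norm (B *v e3) = 1"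
    and nz: "(A *v e3) \<times> (B *v e3) \<noteq> 0" and k: "k\<^sub>0 > 0"
    and \<beta>: "(1 + c A B) * (1 - cos \<beta>) \<le> 2"
  shows "A *v h k\<^sub>0 (\<gamma> k\<^sub>0 A B \<beta>) = \<sigma> k\<^sub>0 A B \<beta>"
proof -
  define u where "u = A *v e3"
  define v where "v = B *v e3"
  define y where "y = v2 A B"
  let ?x = "transpose A *v \<sigma> k\<^sub>0 A B \<beta>"
  have uv: "u \<bullet> u = 1" "v \<bullet> v = 1" "v \<bullet> u = c A B" "u \<bullet> v = c A B"
    using B rotation_norm[OF A, of e3]
    by (simp_all add: u_def v_def c_def norm_eq_1 inner_commute)
  have "norm y = 1" using nz by (simp add: y_def v2_def)
  then have y: "y \<bullet> y = 1" "y \<bullet> u = 0" "y \<bullet> v = 0" "u \<bullet> y = 0" "v \<bullet> y = 0"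
    by (simp_all add: norm_eq_1) (simp_all add: y_def v2_def u_def v_def dot_cross_self)
  have a: "(a k\<^sub>0 A B)\<^sup>2 = k\<^sub>0\<^sup>2 / 2 * (1 + c A B)"
    unfolding a_def power_mult_distrib power2_norm_eq_inner u_def[symmetric] v_def[symmetric]
    by (simp add: inner_add uv power_divide algebra_simps)
  have third: "?x $ 3 = k\<^sub>0 / 2 * (cos \<beta> - 1) * (1 + c A B)"
  proof -
    have "?x $ 3 = \<sigma> k\<^sub>0 A B \<beta> \<bullet> u"
      by (metis A inner_e3 rotation_inner rotation_transpose_cancel(2) u_def)
    then show ?thesis
      by (simp add: \<sigma>_eq flip: u_def v_def y_def) (simp add: inner_add uv y)
  qed
  have "?x \<bullet> ?x = \<sigma> k\<^sub>0 A B \<beta> \<bullet> \<sigma> k\<^sub>0 A B \<beta>"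
    by (rule rotation_inner[OF rotation_matrix_transpose[OF A]])
  also have "\<dots> = (k\<^sub>0 / 2 * (cos \<beta> - 1))\<^sup>2 * (2 + 2 * c A B) + (a k\<^sub>0 A B)\<^sup>2 * (sin \<beta>)\<^sup>2"
  proof -
    have "(p *\<^sub>R (u + v) + q *\<^sub>R y) \<bullet> (p *\<^sub>R (u + v) + q *\<^sub>R y) = p\<^sup>2 * (2 + 2 * c A B) + q\<^sup>2"
      for p q
      by (simp add: inner_add uv y power2_eq_square algebra_simps)
    then show ?thesis
      by (simp only: \<sigma>_eq power_mult_distrib flip: u_def v_def y_def)
  qed
  also have "\<dots> = - (2 * k\<^sub>0 * ?x $ 3)"
  proof -
    have "(m * (C - 1))\<^sup>2 * (2 + 2 * e) + (2 * m)\<^sup>2 / 2 * (1 + e) * (1 - C\<^sup>2) =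
        - (2 * (2 * m) * (m * (C - 1) * (1 + e)))" for m C e :: real
      by (simp add: power2_eq_square algebra_simps)
    from this[of "k\<^sub>0 / 2" "cos \<beta>" "c A B"] show ?thesis
      unfolding third a sin_squared_eq by simp
  qed
  finally have "?x \<bullet> ?x + 2 * k\<^sub>0 * ?x $ 3 = 0" by simp
  moreover have "?x $ 3 + k\<^sub>0 \<ge> 0"
  proof -
    have "?x $ 3 + k\<^sub>0 = k\<^sub>0 / 2 * (2 - (1 + c A B) * (1 - cos \<beta>))"
      unfolding third by (simp add: field_simps)
    also have "\<dots> \<ge> 0" using k \<beta> by simp
    finally show ?thesis .
  qed
  ultimately have "h k\<^sub>0 (P ?x) = ?x" by (rule h_P_eqI)
  then show ?thesis by (simp add: P_\<sigma>[OF A] rotation_transpose_cancel[OF A])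
qed

text \<open>Replacing \<open>B\<close> by \<open>-B\<close> exchanges sum and difference of the axes and reverses the cross product.\<close>

lemma star_eq_minus:
  "\<sigma>_star k\<^sub>0 A B = \<sigma> k\<^sub>0 A (- B)"
  "\<gamma>_star k\<^sub>0 A B = \<gamma> k\<^sub>0 A (- B)"
  "J_star A B = J A (- B)"
proof -
  interpret P: linear P by (rule linear_P)
  have M: "(transpose A ** (- B)) *v e3 = - ((transpose A ** B) *v e3)"
    by (simp add: minus_matrix_vector matrix_vector_minus flip: matrix_vector_mul_assoc)
  show "\<sigma>_star k\<^sub>0 A B = \<sigma> k\<^sub>0 A (- B)"
    by (rule ext) (simp add: \<sigma>_star_def \<sigma>_def a_star_def a_def v3_def v1_def v2_def minus_matrix_vector)
  show "\<gamma>_star k\<^sub>0 A B = \<gamma> k\<^sub>0 A (- B)"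
    by (rule ext) (simp add: \<gamma>_star_def \<gamma>_def a_star_def a_def a_tilde_def w1_def w2_def minus_matrix_vector M P.neg)
  have "(c A B + 1) / (c A B - 1) = (- c A B - 1) / (- c A B + 1)"
    using minus_divide_divide[of "c A B + 1" "c A B - 1"] by simp
  then show "J_star A B = J A (- B)"
    unfolding J_star_def J_def by (simp add: c_def minus_matrix_vector)
qed

lemma \<sigma>_swap: "\<sigma> k\<^sub>0 B A (- \<beta>) = \<sigma> k\<^sub>0 A B \<beta>"
  unfolding \<sigma>_def a_def v1_def v2_def cross_skew[of "B *v e3"] by (simp add: add.commute)

text \<open>Exchanging the two times maps the reflected arc to its negative, with the same parameter: hence the
  starred equation has \<open>\<beta>\<close> on both sides and a conjugate.\<close>

lemma \<sigma>_swap_minus: "\<sigma> k\<^sub>0 B (- A) \<beta> = - \<sigma> k\<^sub>0 A (- B) \<beta>"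
  unfolding \<sigma>_eq a_def v2_def minus_matrix_vector cross_minus_right cross_skew[of "B *v e3"]
  by (simp add: norm_minus_commute algebra_simps)

text \<open>Evaluating at a small \<open>\<beta>\<close> and at \<open>-\<beta>\<close> separates the two coordinates of \<open>\<sigma>\<close>, one being even and the
  other odd in \<open>\<beta>\<close>.\<close>

lemma phases_on_arc_determine:
  assumes B: "(A *v e3) \<times> (B *v e3) \<noteq> 0" and k: "k\<^sub>0 > 0"
    and F: "isCont (fourier f) 0" "fourier f 0 \<noteq> 0"
    and eq: "\<And>\<beta>. \<beta> \<in> J A B \<Longrightarrow> fourier f (\<sigma> k\<^sub>0 A B \<beta>) \<noteq> 0 \<Longrightarrow>
      exp (\<i> * complex_of_real (z \<bullet> \<sigma> k\<^sub>0 A B \<beta>)) = exp (\<i> * complex_of_real (w \<bullet> \<sigma> k\<^sub>0 A B \<beta>))"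
  shows "(z - w) \<bullet> (A *v e3 + B *v e3) = 0" "(z - w) \<bullet> ((A *v e3) \<times> (B *v e3)) = 0"
proof -
  let ?\<phi> = "\<sigma> k\<^sub>0 A B"
  have 0: "?\<phi> 0 = 0" by (simp add: \<sigma>_def)
  have "isCont (\<lambda>\<beta>. fourier f (?\<phi> \<beta>)) 0"
    by (rule isCont_o2[OF isCont_\<sigma>]) (simp only: 0 F)
  then have "((\<lambda>\<beta>. fourier f (?\<phi> \<beta>)) \<longlongrightarrow> fourier f 0) (nhds 0)"
    using 0 by (metis isCont_tendsto_nhds)
  then have "eventually (\<lambda>\<beta>. fourier f (?\<phi> \<beta>) \<noteq> 0) (nhds 0)"
    using F(2) by (rule tendsto_imp_eventually_ne)
  with eventually_in_J[of A B] have "eventually (\<lambda>\<beta>. exp (\<i> * complex_of_real (z \<bullet> ?\<phi> \<beta>)) =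
      exp (\<i> * complex_of_real (w \<bullet> ?\<phi> \<beta>))) (nhds 0)"
    by eventually_elim (rule eq)
  from phase_eq_imp_eventually_orthogonal[OF isCont_\<sigma> 0 this]
  obtain e where e: "e > 0" "\<And>\<beta>. \<bar>\<beta>\<bar> < e \<Longrightarrow> (z - w) \<bullet> ?\<phi> \<beta> = 0"
    unfolding eventually_nhds_metric by (auto simp: dist_real_def)
  \<comment> \<open>any parameter below both \<open>e\<close> and \<open>pi\<close> will do: its sine and its cosine minus 1 are nonzero\<close>
  define \<beta> where "\<beta> = min (e / 2) 1"
  have \<beta>: "0 < \<beta>" "\<beta> < e" "\<beta> < pi" using e(1) pi_gt3 by (auto simp: \<beta>_def)
  have s: "sin \<beta> > 0" using \<beta> by (simp add: sin_gt_zero)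
  have cs: "cos \<beta> \<noteq> 1" using cos_monotone_0_pi[of 0 \<beta>] \<beta> by simp
  define p where "p = k\<^sub>0 / 2 * (cos \<beta> - 1) * ((z - w) \<bullet> (A *v e3 + B *v e3))"
  define q where "q = a k\<^sub>0 A B * sin \<beta> * ((z - w) \<bullet> v2 A B)"
  have "p + q = 0" "p - q = 0"
    using e(2)[of \<beta>] e(2)[of "- \<beta>"] \<beta>
    by (simp_all add: \<sigma>_eq inner_add_right[of _ "_ *\<^sub>R _" "_ *\<^sub>R _"] inner_diff_right p_def q_def)
  then have pq: "p = 0" "q = 0" by simp_all
  show "(z - w) \<bullet> (A *v e3 + B *v e3) = 0"
    using pq(1) k cs by (simp add: p_def)
  have "A *v e3 + B *v e3 \<noteq> 0"
    using B by (metis cross_minus_right cross_refl neg_0_equal_iff_equal add.inverse_unique)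
  then have "(z - w) \<bullet> v2 A B = 0"
    using pq(2) k s by (simp add: q_def a_def)
  then show "(z - w) \<bullet> ((A *v e3) \<times> (B *v e3)) = 0"
    using B by (simp add: v2_def)
qed

section \<open>A full hemisphere of frequencies\<close>

lemma h_0: "k\<^sub>0 > 0 \<Longrightarrow> h k\<^sub>0 0 = 0"
  by (simp add: h_def vec_eq_iff forall_3)

lemma isCont_h: "isCont (h k\<^sub>0) k"
proof -
  have "h k\<^sub>0 = (\<lambda>k. (k $ 1) *\<^sub>R axis 1 1 + (k $ 2) *\<^sub>R axis 2 1 +
      (sqrt (k\<^sub>0\<^sup>2 - (norm k)\<^sup>2) - k\<^sub>0) *\<^sub>R axis 3 1)"
    by (rule ext) (simp add: h_def vec_eq_iff forall_3 axis_def)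
  then show ?thesis by (simp only:) (intro continuous_intros)
qed

text \<open>Three points of a small circle of latitude suffice: two opposite ones isolate the third component
  of \<open>z - w\<close> (in the frame of \<open>A\<close>), and then each of two perpendicular ones isolates another.\<close>

lemma phases_on_hemisphere_determine:
  assumes A: "rotation_matrix A" and k: "k\<^sub>0 > 0"
    and F: "isCont (fourier f) 0" "fourier f 0 \<noteq> 0"
    and eq: "\<And>k. k \<in> ball 0 k\<^sub>0 \<Longrightarrow> fourier f (A *v h k\<^sub>0 k) \<noteq> 0 \<Longrightarrow>
      exp (\<i> * complex_of_real (z \<bullet> (A *v h k\<^sub>0 k))) = exp (\<i> * complex_of_real (w \<bullet> (A *v h k\<^sub>0 k)))"
  shows "z = w"
proof -
  let ?\<phi> = "\<lambda>k. A *v h k\<^sub>0 k"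
  have 0: "?\<phi> 0 = 0" using k by (simp add: h_0)
  have cont: "isCont ?\<phi> 0"
    by (rule isCont_o2[OF isCont_h]) (simp add: linear_continuous_at)
  have "isCont (\<lambda>k. fourier f (?\<phi> k)) 0"
    by (rule isCont_o2[OF cont]) (simp only: 0 F)
  then have "((\<lambda>k. fourier f (?\<phi> k)) \<longlongrightarrow> fourier f 0) (nhds 0)"
    using 0 by (metis isCont_tendsto_nhds)
  then have "eventually (\<lambda>k. fourier f (?\<phi> k) \<noteq> 0) (nhds 0)"
    using F(2) by (rule tendsto_imp_eventually_ne)
  moreover have "eventually (\<lambda>k. k \<in> ball 0 k\<^sub>0) (nhds (0::real^2))"
    using k by (intro eventually_nhds_in_open) auto
  ultimately have "eventually (\<lambda>k. exp (\<i> * complex_of_real (z \<bullet> ?\<phi> k)) =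
      exp (\<i> * complex_of_real (w \<bullet> ?\<phi> k))) (nhds 0)"
    by eventually_elim (rule eq)
  from phase_eq_imp_eventually_orthogonal[OF cont 0 this]
  obtain e where e: "e > 0" "\<And>k. norm k < e \<Longrightarrow> (z - w) \<bullet> ?\<phi> k = 0"
    unfolding eventually_nhds_metric by auto
  define y where "y = transpose A *v (z - w)"
  have y: "y \<bullet> h k\<^sub>0 k = 0" if "norm k < e" for k
  proof -
    have "z - w = A *v y" by (simp add: y_def rotation_transpose_cancel(2)[OF A])
    then show ?thesis using e(2)[OF that] by (simp only: rotation_inner[OF A])
  qed
  define b where "b = min (e / 2) (k\<^sub>0 / 2)"
  have b: "0 < b" "b < e" "b < k\<^sub>0" using e(1) k by (auto simp: b_def)
  \<comment> \<open>the common height of the points of \<open>h k\<^sub>0\<close> over the circle of radius \<open>b\<close>\<close>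
  define q where "q = sqrt (k\<^sub>0\<^sup>2 - b\<^sup>2) - k\<^sub>0"
  have hb: "h k\<^sub>0 (r *\<^sub>R axis j 1) = (\<chi> i. if i = 3 then q else if i = (if j = 1 then 1 else 2) then r else 0)"
    if "\<bar>r\<bar> = b" for r j
  proof -
    have "norm (r *\<^sub>R (axis j 1 :: real^2)) = b" using that by simp
    then have "h k\<^sub>0 (r *\<^sub>R axis j 1) = vector [(r *\<^sub>R axis j 1) $ 1, (r *\<^sub>R axis j 1) $ 2, q]"
      by (simp only: h_def q_def)
    also have "\<dots> = (\<chi> i. if i = 3 then q else if i = (if j = 1 then 1 else 2) then r else 0)"
      using exhaust_2[of j] by (auto simp: vec_eq_iff forall_3 axis_def)
    finally show ?thesis .
  qed
  have n: "norm (r *\<^sub>R (axis j 1 :: real^2)) < e" if "\<bar>r\<bar> = b" for r j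
    using that b by (simp only: norm_scaleR norm_axis_1 real_norm_def mult_1_right)
  have "sqrt (k\<^sub>0\<^sup>2 - b\<^sup>2) < sqrt (k\<^sub>0\<^sup>2)"
    using b by (intro real_sqrt_less_mono) simp
  then have "q \<noteq> 0" using k by (simp add: q_def)
  have "y \<bullet> (\<chi> i. if i = 3 then q else if i = (if j = 1 then 1 else 2) then r else 0) = 0"
    if "\<bar>r\<bar> = b" for r and j :: 2
    using y[OF n[OF that, of j]] unfolding hb[OF that, of j] .
  from this[of b 1] this[of "- b" 1] this[of b 2]
  have "b * y $ 1 + q * y $ 3 = 0" "- b * y $ 1 + q * y $ 3 = 0" "b * y $ 2 + q * y $ 3 = 0"
    using b by (simp_all add: inner_vec_def sum_3 mult.commute)
  with \<open>q \<noteq> 0\<close> b have "y = 0"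
    by (simp add: vec_eq_iff forall_3)
  then have "z - w = 0"
    unfolding y_def by (metis A matrix_vector_mult_0_right rotation_transpose_cancel(2))
  then show ?thesis by simp
qed

section \<open>Relative rotations that preserve the axis\<close>

lemma rotation_fixing_e3:
  assumes M: "rotation_matrix M" and e: "M *v e3 = e3"
  shows "\<exists>\<alpha>. M = Q3 \<alpha>"
proof -
  have c3: "M $ 1 $ 3 = 0" "M $ 2 $ 3 = 0" "M $ 3 $ 3 = 1"
    using e by (simp_all add: matrix_vector_mult_def e3_def vec_eq_iff forall_3 sum_3)
  have "transpose M *v e3 = e3"
    using rotation_transpose_cancel(1)[OF M, of e3] e by simp
  then have r3: "M $ 3 $ 1 = 0" "M $ 3 $ 2 = 0"
    by (simp_all add: matrix_vector_mult_def e3_def vec_eq_iff forall_3 sum_3 transpose_def)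
  have "transpose M ** M = mat 1"
    using M by (simp add: rotation_matrix_def orthogonal_matrix_def)
  then have o: "(M $ 1 $ 1)\<^sup>2 + (M $ 2 $ 1)\<^sup>2 = 1" "M $ 1 $ 1 * M $ 1 $ 2 + M $ 2 $ 1 * M $ 2 $ 2 = 0"
    by (simp_all add: matrix_matrix_mult_def transpose_def mat_def vec_eq_iff forall_3 sum_3 r3
        power2_eq_square)
  have d: "M $ 1 $ 1 * M $ 2 $ 2 - M $ 1 $ 2 * M $ 2 $ 1 = 1"
    using M by (simp add: rotation_matrix_def det_3 c3 r3)
  obtain \<alpha> where \<alpha>: "M $ 1 $ 1 = cos \<alpha>" "M $ 2 $ 1 = sin \<alpha>"
    using sincos_total_2pi[OF o(1)] by metis
  \<comment> \<open>the second column is the solution of the linear system given by orthogonality and determinant\<close>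
  have "M $ 2 $ 2 = ((cos \<alpha>)\<^sup>2 + (sin \<alpha>)\<^sup>2) * M $ 2 $ 2" by simp
  also have "\<dots> = cos \<alpha>" using o(2) d unfolding \<alpha> by algebra
  finally have 22: "M $ 2 $ 2 = cos \<alpha>" .
  have "M $ 1 $ 2 = ((cos \<alpha>)\<^sup>2 + (sin \<alpha>)\<^sup>2) * M $ 1 $ 2" by simp
  also have "\<dots> = - sin \<alpha>" using o(2) d unfolding \<alpha> by algebra
  finally have 12: "M $ 1 $ 2 = - sin \<alpha>" .
  have "M = Q3 \<alpha>"
    by (simp add: Q3_def vec_eq_iff forall_3 c3 r3 \<alpha> 22 12)
  then show ?thesis ..
qed

lemma Q2_pi_mult: "Q2 pi *v x = vector [- x $ 1, x $ 2, - x $ 3]"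
  by (simp add: Q2_def matrix_vector_mult_def vec_eq_iff forall_3 sum_3)

lemma rotation_matrix_Q2_pi: "rotation_matrix (Q2 pi)"
  by (simp add: rotation_matrix_def orthogonal_matrix_def Q2_def det_3
      matrix_matrix_mult_def transpose_def mat_def vec_eq_iff forall_3 sum_3)

lemma Q2_pi_involution: "Q2 pi ** Q2 pi = mat 1"
  by (simp add: Q2_def matrix_matrix_mult_def mat_def vec_eq_iff forall_3 sum_3)

lemma rotation_reversing_e3:
  assumes M: "rotation_matrix M" and e: "M *v e3 = - e3"
  shows "\<exists>\<alpha>. M = Q2 pi ** Q3 \<alpha>"
proof -
  have "(Q2 pi ** M) *v e3 = e3"
    unfolding matrix_vector_mul_assoc[symmetric] e
    by (simp add: Q2_pi_mult e3_def vec_eq_iff forall_3)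
  then obtain \<alpha> where "Q2 pi ** M = Q3 \<alpha>"
    using rotation_fixing_e3 rotation_matrix_mult[OF rotation_matrix_Q2_pi M] by blast
  then have "M = Q2 pi ** Q3 \<alpha>"
    by (metis Q2_pi_involution matrix_mul_assoc matrix_mul_lid)
  then show ?thesis ..
qed

lemma Q_inverse: "Q \<alpha> *v (Q (- \<alpha>) *v k) = k"
proof -
  have "Q \<alpha> ** Q (- \<alpha>) = mat 1"
    using sin_cos_squared_add[of \<alpha>]
    by (simp add: Q_def matrix_matrix_mult_def mat_def vec_eq_iff forall_2 sum_2 power2_eq_square add.commute)
  then show ?thesis by (simp add: matrix_vector_mul_assoc)
qed

lemma norm_Q: "norm (Q \<alpha> *v k) = norm k"
proof -
  have "(Q \<alpha> *v k) \<bullet> (Q \<alpha> *v k) = ((cos \<alpha>)\<^sup>2 + (sin \<alpha>)\<^sup>2) * (k \<bullet> k)"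
    by (simp add: Q_def matrix_vector_mult_def inner_vec_def sum_2 power2_eq_square algebra_simps
        del: sin_cos_squared_add sin_cos_squared_add2 sin_cos_squared_add3)
  then show ?thesis by (simp add: norm_eq_sqrt_inner)
qed

lemma Q3_h: "Q3 \<alpha> *v h k\<^sub>0 k = h k\<^sub>0 (Q \<alpha> *v k)"
  by (simp add: h_def norm_Q)
    (simp add: Q3_def Q_def matrix_vector_mult_def vec_eq_iff forall_3 sum_3 sum_2)

text \<open>The half-turn about the second axis reverses the first and third coordinates, and \<open>S\<close> reverses
  the second.\<close>

lemma Q2_pi_h_S: "Q2 pi *v h k\<^sub>0 (S *v k) = - h k\<^sub>0 k"
proof -
  have "norm (S *v k) = norm k"
    by (simp add: norm_eq_sqrt_inner S_def matrix_vector_mult_def inner_vec_def sum_2)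
  then show ?thesis
    by (simp add: Q2_pi_mult h_def)
      (simp add: S_def matrix_vector_mult_def vec_eq_iff forall_3 sum_2)
qed

section \<open>Determination of the relative translation\<close>

theorem theorem5p3:
  fixes k\<^sub>0 T s t :: real
    and f :: "real^3 \<Rightarrow> real"
    and R :: "real \<Rightarrow> real^3^3"
    and d :: "real \<Rightarrow> real^3"
  assumes "k\<^sub>0 > 0" and "T > 0"
    and "\<And>x. f x \<ge> 0"
    and "piecewise_continuous f"
    and "\<exists>r>0. closure {x. f x \<noteq> 0} \<subseteq> ball 0 r"
    and "\<not> (AE x in lebesgue. f x = 0)"
    and "\<And>\<tau>. \<tau> \<in> {0..T} \<Longrightarrow> rotation_matrix (R \<tau>)"
    and "R 0 = mat 1" and "d 0 = 0"
    and "s \<in> {0..T}" and "t \<in> {0..T}"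
  shows
    "(R s *v e3 \<noteq> R t *v e3 \<and> R s *v e3 \<noteq> - (R t *v e3) \<longrightarrow>
        (\<forall>x. ((\<forall>\<beta>\<in>J (R s) (R t). \<mu> f k\<^sub>0 R d s (\<gamma> k\<^sub>0 (R s) (R t) \<beta>) \<noteq> 0 \<longrightarrow>
                  exp (\<i> * complex_of_real ((R s *v x) \<bullet> \<sigma> k\<^sub>0 (R s) (R t) \<beta>)) =
                  \<mu> f k\<^sub>0 R d s (\<gamma> k\<^sub>0 (R s) (R t) \<beta>) /
                  \<mu> f k\<^sub>0 R d t (\<gamma> k\<^sub>0 (R t) (R s) (- \<beta>))) \<and>
              (\<forall>\<beta>\<in>J_star (R s) (R t). \<mu> f k\<^sub>0 R d s (\<gamma>_star k\<^sub>0 (R s) (R t) \<beta>) \<noteq> 0 \<longrightarrow>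
                  exp (\<i> * complex_of_real ((R s *v x) \<bullet> \<sigma>_star k\<^sub>0 (R s) (R t) \<beta>)) =
                  \<mu> f k\<^sub>0 R d s (\<gamma>_star k\<^sub>0 (R s) (R t) \<beta>) /
                  cnj (\<mu> f k\<^sub>0 R d t (\<gamma>_star k\<^sub>0 (R t) (R s) \<beta>))))
             \<longleftrightarrow> x = (transpose (R s) ** R t) *v d t - d s))
   \<and> (R s *v e3 = R t *v e3 \<longrightarrow>
        (\<exists>\<alpha>. transpose (R s) ** R t = Q3 \<alpha>) \<and>
        (\<forall>\<alpha>. transpose (R s) ** R t = Q3 \<alpha> \<longrightarrow>
          (\<forall>x. (\<forall>k\<in>ball 0 k\<^sub>0. \<mu> f k\<^sub>0 R d s k \<noteq> 0 \<longrightarrow>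
                  exp (\<i> * complex_of_real ((R s *v x) \<bullet> (R s *v h k\<^sub>0 k))) =
                  \<mu> f k\<^sub>0 R d s k / \<mu> f k\<^sub>0 R d t (Q (- \<alpha>) *v k))
               \<longleftrightarrow> x = (transpose (R s) ** R t) *v d t - d s)))
   \<and> (R s *v e3 = - (R t *v e3) \<longrightarrow>
        (\<exists>\<alpha>. transpose (R s) ** R t = Q2 pi ** Q3 \<alpha>) \<and>
        (\<forall>\<alpha>. transpose (R s) ** R t = Q2 pi ** Q3 \<alpha> \<longrightarrow>
          (\<forall>x. (\<forall>k\<in>ball 0 k\<^sub>0. \<mu> f k\<^sub>0 R d s k \<noteq> 0 \<longrightarrow>
                  exp (\<i> * complex_of_real ((R s *v x) \<bullet> (R s *v h k\<^sub>0 k))) =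
                  \<mu> f k\<^sub>0 R d s k / cnj (\<mu> f k\<^sub>0 R d t ((Q (- \<alpha>) ** S) *v k)))
               \<longleftrightarrow> x = (transpose (R s) ** R t) *v d t - d s)))"
proof -
  let ?A = "R s" and ?B = "R t"
  have A: "rotation_matrix ?A" and B: "rotation_matrix ?B" using assms by blast+
  have f: "integrable lebesgue f"
    using assms(4,5) integrable_piecewise_continuous by blast
  have F: "isCont (fourier f) 0" "fourier f 0 \<noteq> 0"
    using isCont_fourier[OF f] fourier_0_nonzero[OF f assms(3,6)] by auto
  define w where "w = ?B *v d t - ?A *v d s"
  have x_iff: "x = (transpose ?A ** ?B) *v d t - d s \<longleftrightarrow> ?A *v x = w" for x
  proof -
    have "(transpose ?A ** ?B) *v d t - d s = transpose ?A *v w"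
      by (simp add: w_def matrix_vector_mult_diff_distrib rotation_transpose_cancel[OF A]
          flip: matrix_vector_mul_assoc)
    then show ?thesis by (auto simp: rotation_transpose_cancel[OF A])
  qed
  have nA: "norm (?A *v e3) = 1" "norm (?B *v e3) = 1"
    by (simp_all add: rotation_norm A B)
  have nAm: "norm ((- ?A) *v e3) = 1" "norm ((- ?B) *v e3) = 1"
    by (simp_all add: minus_matrix_vector nA)
  have c_ge: "c A' B' \<ge> -1" if "norm (A' *v e3) = 1" "norm (B' *v e3) = 1" for A' B'
    using Cauchy_Schwarz_ineq2[of "A' *v e3" "B' *v e3"] that by (simp add: c_def)
  \<comment> \<open>independent axes: both families of equations become equalities of phases along \<open>\<sigma>\<close>, the
    starred family for \<open>-B\<close> in place of \<open>B\<close>\<close>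
  have part1: "((\<forall>\<beta>\<in>J ?A ?B. \<mu> f k\<^sub>0 R d s (\<gamma> k\<^sub>0 ?A ?B \<beta>) \<noteq> 0 \<longrightarrow>
                  exp (\<i> * complex_of_real ((?A *v x) \<bullet> \<sigma> k\<^sub>0 ?A ?B \<beta>)) =
                  \<mu> f k\<^sub>0 R d s (\<gamma> k\<^sub>0 ?A ?B \<beta>) / \<mu> f k\<^sub>0 R d t (\<gamma> k\<^sub>0 ?B ?A (- \<beta>))) \<and>
              (\<forall>\<beta>\<in>J_star ?A ?B. \<mu> f k\<^sub>0 R d s (\<gamma>_star k\<^sub>0 ?A ?B \<beta>) \<noteq> 0 \<longrightarrow>
                  exp (\<i> * complex_of_real ((?A *v x) \<bullet> \<sigma>_star k\<^sub>0 ?A ?B \<beta>)) =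
                  \<mu> f k\<^sub>0 R d s (\<gamma>_star k\<^sub>0 ?A ?B \<beta>) / cnj (\<mu> f k\<^sub>0 R d t (\<gamma>_star k\<^sub>0 ?B ?A \<beta>))))
             \<longleftrightarrow> x = (transpose ?A ** ?B) *v d t - d s" (is "?E \<and> ?E' \<longleftrightarrow> _")
    if ne: "?A *v e3 \<noteq> ?B *v e3" "?A *v e3 \<noteq> - (?B *v e3)" for x
  proof -
    have nz: "(?A *v e3) \<times> (?B *v e3) \<noteq> 0"
      using cross_nonzero_of_unit nA ne by blast
    have nz': "(?A *v e3) \<times> ((- ?B) *v e3) \<noteq> 0" "(?B *v e3) \<times> (?A *v e3) \<noteq> 0"
      "(?B *v e3) \<times> ((- ?A) *v e3) \<noteq> 0"
      using nz by (simp_all add: minus_matrix_vector cross_skew[of "?B *v e3"])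
    have cs: "c ?B ?A = c ?A ?B" "c ?B (- ?A) = c ?A (- ?B)"
      by (simp_all add: c_def inner_commute minus_matrix_vector)
    have arc: "?A *v h k\<^sub>0 (\<gamma> k\<^sub>0 ?A ?B \<beta>) = \<sigma> k\<^sub>0 ?A ?B \<beta>"
      "?B *v h k\<^sub>0 (\<gamma> k\<^sub>0 ?B ?A (- \<beta>)) = \<sigma> k\<^sub>0 ?A ?B \<beta>" if "\<beta> \<in> J ?A ?B" for \<beta>
      using cos_bound_on_J[OF that c_ge[OF nA]] rotation_h_\<gamma>[OF A nA(2) nz assms(1)]
        rotation_h_\<gamma>[OF B nA(1) nz'(2) assms(1)]
      by (simp_all add: cs \<sigma>_swap)
    have arc': "?A *v h k\<^sub>0 (\<gamma> k\<^sub>0 ?A (- ?B) \<beta>) = \<sigma> k\<^sub>0 ?A (- ?B) \<beta>"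
      "?B *v h k\<^sub>0 (\<gamma> k\<^sub>0 ?B (- ?A) \<beta>) = - \<sigma> k\<^sub>0 ?A (- ?B) \<beta>" if "\<beta> \<in> J ?A (- ?B)" for \<beta>
      using cos_bound_on_J[OF that c_ge[OF nA(1) nAm(2)]] rotation_h_\<gamma>[OF A nAm(2) nz'(1) assms(1)]
        rotation_h_\<gamma>[OF B nAm(1) nz'(3) assms(1)]
      by (simp_all add: cs \<sigma>_swap_minus[of k\<^sub>0 ?B ?A])
    have E: "?E \<longleftrightarrow> (\<forall>\<beta>\<in>J ?A ?B. fourier f (\<sigma> k\<^sub>0 ?A ?B \<beta>) \<noteq> 0 \<longrightarrow>
        exp (\<i> * complex_of_real ((?A *v x) \<bullet> \<sigma> k\<^sub>0 ?A ?B \<beta>)) =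
        exp (\<i> * complex_of_real (w \<bullet> \<sigma> k\<^sub>0 ?A ?B \<beta>)))"
    proof (intro ball_cong refl imp_cong)
      fix \<beta> assume \<beta>: "\<beta> \<in> J ?A ?B"
      show "\<mu> f k\<^sub>0 R d s (\<gamma> k\<^sub>0 ?A ?B \<beta>) \<noteq> 0 \<longleftrightarrow> fourier f (\<sigma> k\<^sub>0 ?A ?B \<beta>) \<noteq> 0"
        by (simp add: data_nonzero_iff arc(1)[OF \<beta>])
      assume "fourier f (\<sigma> k\<^sub>0 ?A ?B \<beta>) \<noteq> 0"
      then have "\<mu> f k\<^sub>0 R d s (\<gamma> k\<^sub>0 ?A ?B \<beta>) / \<mu> f k\<^sub>0 R d t (\<gamma> k\<^sub>0 ?B ?A (- \<beta>)) =
          exp (\<i> * complex_of_real (w \<bullet> \<sigma> k\<^sub>0 ?A ?B \<beta>))"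
        using data_ratio[of R s t k\<^sub>0 "\<gamma> k\<^sub>0 ?B ?A (- \<beta>)" "\<gamma> k\<^sub>0 ?A ?B \<beta>" f d] A B arc[OF \<beta>]
        by (simp add: data_nonzero_iff w_def)
      then show "exp (\<i> * complex_of_real ((?A *v x) \<bullet> \<sigma> k\<^sub>0 ?A ?B \<beta>)) =
          \<mu> f k\<^sub>0 R d s (\<gamma> k\<^sub>0 ?A ?B \<beta>) / \<mu> f k\<^sub>0 R d t (\<gamma> k\<^sub>0 ?B ?A (- \<beta>)) \<longleftrightarrow>
        exp (\<i> * complex_of_real ((?A *v x) \<bullet> \<sigma> k\<^sub>0 ?A ?B \<beta>)) =
        exp (\<i> * complex_of_real (w \<bullet> \<sigma> k\<^sub>0 ?A ?B \<beta>))" by simp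
    qed
    have E': "?E' \<longleftrightarrow> (\<forall>\<beta>\<in>J ?A (- ?B). fourier f (\<sigma> k\<^sub>0 ?A (- ?B) \<beta>) \<noteq> 0 \<longrightarrow>
        exp (\<i> * complex_of_real ((?A *v x) \<bullet> \<sigma> k\<^sub>0 ?A (- ?B) \<beta>)) =
        exp (\<i> * complex_of_real (w \<bullet> \<sigma> k\<^sub>0 ?A (- ?B) \<beta>)))"
      unfolding star_eq_minus
    proof (intro ball_cong refl imp_cong)
      fix \<beta> assume \<beta>: "\<beta> \<in> J ?A (- ?B)"
      show "\<mu> f k\<^sub>0 R d s (\<gamma> k\<^sub>0 ?A (- ?B) \<beta>) \<noteq> 0 \<longleftrightarrow> fourier f (\<sigma> k\<^sub>0 ?A (- ?B) \<beta>) \<noteq> 0"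
        by (simp add: data_nonzero_iff arc'(1)[OF \<beta>])
      assume "fourier f (\<sigma> k\<^sub>0 ?A (- ?B) \<beta>) \<noteq> 0"
      then have "\<mu> f k\<^sub>0 R d s (\<gamma> k\<^sub>0 ?A (- ?B) \<beta>) / cnj (\<mu> f k\<^sub>0 R d t (\<gamma> k\<^sub>0 ?B (- ?A) \<beta>)) =
          exp (\<i> * complex_of_real (w \<bullet> \<sigma> k\<^sub>0 ?A (- ?B) \<beta>))"
        using data_ratio_antipodal[of R s t k\<^sub>0 "\<gamma> k\<^sub>0 ?B (- ?A) \<beta>" "\<gamma> k\<^sub>0 ?A (- ?B) \<beta>" f d]
          A B arc'[OF \<beta>]
        by (simp add: data_nonzero_iff w_def)
      then show "exp (\<i> * complex_of_real ((?A *v x) \<bullet> \<sigma> k\<^sub>0 ?A (- ?B) \<beta>)) =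
          \<mu> f k\<^sub>0 R d s (\<gamma> k\<^sub>0 ?A (- ?B) \<beta>) / cnj (\<mu> f k\<^sub>0 R d t (\<gamma> k\<^sub>0 ?B (- ?A) \<beta>)) \<longleftrightarrow>
        exp (\<i> * complex_of_real ((?A *v x) \<bullet> \<sigma> k\<^sub>0 ?A (- ?B) \<beta>)) =
        exp (\<i> * complex_of_real (w \<bullet> \<sigma> k\<^sub>0 ?A (- ?B) \<beta>))" by simp
    qed
    show ?thesis
      unfolding x_iff
    proof
      assume "?E \<and> ?E'"
      with E E' have
        "(?A *v x - w) \<bullet> (?A *v e3 + ?B *v e3) = 0"
        "(?A *v x - w) \<bullet> ((?A *v e3) \<times> (?B *v e3)) = 0"
        "(?A *v x - w) \<bullet> (?A *v e3 + (- ?B) *v e3) = 0"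
        using phases_on_arc_determine[OF nz assms(1) F, of "?A *v x" w]
          phases_on_arc_determine(1)[OF nz'(1) assms(1) F, of "?A *v x" w] by blast+
      then have "(?A *v x - w) \<bullet> (?A *v e3) = 0" "(?A *v x - w) \<bullet> (?B *v e3) = 0"
        "(?A *v x - w) \<bullet> ((?A *v e3) \<times> (?B *v e3)) = 0"
        by (simp_all add: inner_add_right inner_diff_right minus_matrix_vector)
      then show "?A *v x = w"
        using eq_0_of_orthogonal_cross[OF nz, of "?A *v x - w"] by simp
    next
      assume "?A *v x = w"
      then show "?E \<and> ?E'" unfolding E E' by simp
    qed
  qed
  \<comment> \<open>parallel and antiparallel axes differ only in which quotient of data yields the phase\<close>
  have hemi: "(\<forall>k\<in>ball 0 k\<^sub>0. \<mu> f k\<^sub>0 R d s k \<noteq> 0 \<longrightarrow>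
        exp (\<i> * complex_of_real ((?A *v x) \<bullet> (?A *v h k\<^sub>0 k))) = ratio k)
      \<longleftrightarrow> x = (transpose ?A ** ?B) *v d t - d s"
    if ratio: "\<And>k. \<mu> f k\<^sub>0 R d s k \<noteq> 0 \<Longrightarrow>
      ratio k = exp (\<i> * complex_of_real (w \<bullet> (?A *v h k\<^sub>0 k)))" for x ratio
    unfolding x_iff
  proof
    assume E: "\<forall>k\<in>ball 0 k\<^sub>0. \<mu> f k\<^sub>0 R d s k \<noteq> 0 \<longrightarrow>
        exp (\<i> * complex_of_real ((?A *v x) \<bullet> (?A *v h k\<^sub>0 k))) = ratio k"
    show "?A *v x = w"
    proof (rule phases_on_hemisphere_determine[OF A assms(1) F])
      fix k assume k: "k \<in> ball 0 k\<^sub>0" and "fourier f (?A *v h k\<^sub>0 k) \<noteq> 0"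
      then have "\<mu> f k\<^sub>0 R d s k \<noteq> 0" by (simp only: data_nonzero_iff not_False_eq_True)
      with E k ratio[OF this]
      show "exp (\<i> * complex_of_real ((?A *v x) \<bullet> (?A *v h k\<^sub>0 k))) =
          exp (\<i> * complex_of_real (w \<bullet> (?A *v h k\<^sub>0 k)))" by simp
    qed
  next
    assume "?A *v x = w"
    then show "\<forall>k\<in>ball 0 k\<^sub>0. \<mu> f k\<^sub>0 R d s k \<noteq> 0 \<longrightarrow>
        exp (\<i> * complex_of_real ((?A *v x) \<bullet> (?A *v h k\<^sub>0 k))) = ratio k"
      using ratio by simp
  qed
  have AB: "rotation_matrix (transpose ?A ** ?B)"
    by (intro rotation_matrix_mult rotation_matrix_transpose A B)
  have Bv: "?B *v y = ?A *v ((transpose ?A ** ?B) *v y)" for y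
    by (simp add: rotation_transpose_cancel[OF A] flip: matrix_vector_mul_assoc)
  show ?thesis
  proof (intro conjI impI allI)
    fix x assume "?A *v e3 \<noteq> ?B *v e3 \<and> ?A *v e3 \<noteq> - (?B *v e3)"
    then show "((\<forall>\<beta>\<in>J ?A ?B. \<mu> f k\<^sub>0 R d s (\<gamma> k\<^sub>0 ?A ?B \<beta>) \<noteq> 0 \<longrightarrow>
                  exp (\<i> * complex_of_real ((?A *v x) \<bullet> \<sigma> k\<^sub>0 ?A ?B \<beta>)) =
                  \<mu> f k\<^sub>0 R d s (\<gamma> k\<^sub>0 ?A ?B \<beta>) / \<mu> f k\<^sub>0 R d t (\<gamma> k\<^sub>0 ?B ?A (- \<beta>))) \<and>
              (\<forall>\<beta>\<in>J_star ?A ?B. \<mu> f k\<^sub>0 R d s (\<gamma>_star k\<^sub>0 ?A ?B \<beta>) \<noteq> 0 \<longrightarrow>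
                  exp (\<i> * complex_of_real ((?A *v x) \<bullet> \<sigma>_star k\<^sub>0 ?A ?B \<beta>)) =
                  \<mu> f k\<^sub>0 R d s (\<gamma>_star k\<^sub>0 ?A ?B \<beta>) / cnj (\<mu> f k\<^sub>0 R d t (\<gamma>_star k\<^sub>0 ?B ?A \<beta>))))
             \<longleftrightarrow> x = (transpose ?A ** ?B) *v d t - d s"
      by (intro part1) auto
  next
    assume "?A *v e3 = ?B *v e3"
    then show "\<exists>\<alpha>. transpose ?A ** ?B = Q3 \<alpha>"
      by (intro rotation_fixing_e3[OF AB])
        (metis matrix_vector_mul_assoc rotation_transpose_cancel(1)[OF A])
  next
    fix \<alpha> x assume \<alpha>: "transpose ?A ** ?B = Q3 \<alpha>"
    have "?B *v h k\<^sub>0 (Q (- \<alpha>) *v k) = ?A *v h k\<^sub>0 k" for k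
      by (simp add: Bv \<alpha> Q3_h Q_inverse)
    then show "(\<forall>k\<in>ball 0 k\<^sub>0. \<mu> f k\<^sub>0 R d s k \<noteq> 0 \<longrightarrow>
                  exp (\<i> * complex_of_real ((?A *v x) \<bullet> (?A *v h k\<^sub>0 k))) =
                  \<mu> f k\<^sub>0 R d s k / \<mu> f k\<^sub>0 R d t (Q (- \<alpha>) *v k))
               \<longleftrightarrow> x = (transpose ?A ** ?B) *v d t - d s"
      by (intro hemi data_ratio[of R s t k\<^sub>0 _ _ f d, OF A B, folded w_def])
  next
    assume "?A *v e3 = - (?B *v e3)"
    then have "(transpose ?A ** ?B) *v e3 = - e3"
      by (metis A matrix_vector_minus matrix_vector_mul_assoc minus_minus
          rotation_transpose_cancel(1))
    then show "\<exists>\<alpha>. transpose ?A ** ?B = Q2 pi ** Q3 \<alpha>"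
      by (rule rotation_reversing_e3[OF AB])
  next
    fix \<alpha> x assume \<alpha>: "transpose ?A ** ?B = Q2 pi ** Q3 \<alpha>"
    have "?B *v h k\<^sub>0 ((Q (- \<alpha>) ** S) *v k) = - (?A *v h k\<^sub>0 k)" for k
      unfolding Bv \<alpha> matrix_vector_mul_assoc[symmetric] Q3_h Q_inverse Q2_pi_h_S
      by (rule matrix_vector_minus)
    then show "(\<forall>k\<in>ball 0 k\<^sub>0. \<mu> f k\<^sub>0 R d s k \<noteq> 0 \<longrightarrow>
                  exp (\<i> * complex_of_real ((?A *v x) \<bullet> (?A *v h k\<^sub>0 k))) =
                  \<mu> f k\<^sub>0 R d s k / cnj (\<mu> f k\<^sub>0 R d t ((Q (- \<alpha>) ** S) *v k)))
               \<longleftrightarrow> x = (transpose ?A ** ?B) *v d t - d s"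
      by (intro hemi data_ratio_antipodal[of R s t k\<^sub>0 _ _ f d, OF A B, folded w_def])
  qed
qed

end
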